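(* Kac--Paljutkin's finite quantum group $\mathcal{A}$ (the $8$-dimensional Hopf $*$-algebra $\mathcal{A}=\mathbb{C}\oplus\mathbb{C}\oplus\mathbb{C}\oplus\mathbb{C}\oplus\mathbb{M}_2$ described in the context) is nilpotent as a semisimple Hopf algebra.
   Context: All vector spaces and algebras are over $\mathbb{C}$; $\mathbb{M}_2$ is the algebra of complex $2\times 2$ matrices. **Kac--Paljutkin's finite quantum group.** As a $*$-algebra $\mathcal{A}=\mathbb{C}\oplus\mathbb{C}\oplus\mathbb{C}\oplus\mathbb{C}\oplus\mathbb{M}_2$. Let $e_1,e_2,e_3,e_4$ be the units of the four one-dimensional summands and $a_{ij}$ ($i,j=1,2$) the matrix units of $\mathbb{M}_2$; these $8$ elements form a basis. The comultiplication $\Delta$, counit $\epsilon$ and antipode $S$ are given by $$\Delta(e_1)=e_1\otimes e_1+e_2\otimes e_2+e_3\otimes e_3+e_4\otimes e_4+\tfrac12(a_{11}\otimes a_{11}+a_{12}\otimes a_{12}+a_{21}\otimes a_{21}+a_{22}\otimes a_{22}),$$ $$\Delta(e_2)=e_1\otimes e_2+e_2\otimes e_1+e_3\otimes e_4+e_4\otimes e_3+\tfrac12 a_{11}\otimes a_{22}+\tfrac12 a_{22}\otimes a_{11}-\tfrac{\sqrt{-1}}2a_{12}\otimes a_{21}+\tfrac{\sqrt{-1}}2a_{21}\otimes a_{12},$$ $$\Delta(e_3)=e_1\otimes e_3+e_3\otimes e_1+e_2\otimes e_4+e_4\otimes e_2+\tfrac12 a_{11}\otimes a_{22}+\tfrac12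 a_{22}\otimes a_{11}+\tfrac{\sqrt{-1}}2a_{12}\otimes a_{21}-\tfrac{\sqrt{-1}}2a_{21}\otimes a_{12},$$ $$\Delta(e_4)=e_1\otimes e_4+e_4\otimes e_1+e_2\otimes e_3+e_3\otimes e_2+\tfrac12 a_{11}\otimes a_{11}+\tfrac12 a_{22}\otimes a_{22}-\tfrac12a_{12}\otimes a_{12}-\tfrac12a_{21}\otimes a_{21},$$ $$\Delta(a_{11})=e_1\otimes a_{11}+a_{11}\otimes e_1+e_2\otimes a_{22}+a_{22}\otimes e_2+e_3\otimes a_{22}+a_{22}\otimes e_3+e_4\otimes a_{11}+a_{11}\otimes e_4,$$ $$\Delta(a_{12})=e_1\otimes a_{12}+a_{12}\otimes e_1+\sqrt{-1}\,e_2\otimes a_{21}-\sqrt{-1}\,a_{21}\otimes e_2-\sqrt{-1}\,e_3\otimes a_{21}+\sqrt{-1}\,a_{21}\otimes e_3-e_4\otimes a_{12}-a_{12}\otimes e_4,$$ $$\Delta(a_{21})=e_1\otimes a_{21}+a_{21}\otimes e_1-\sqrt{-1}\,e_2\otimes a_{12}+\sqrt{-1}\,a_{12}\otimes e_2+\sqrt{-1}\,e_3\otimes a_{12}-\sqrt{-1}\,a_{12}\otimes e_3-e_4\otimes a_{21}-a_{21}\otimes e_4,$$ $$\Delta(a_{22})=e_1\otimes a_{22}+a_{22}\otimes e_1+e_2\otimes a_{11}+a_{11}\otimes e_2+e_3\otimes a_{11}+a_{11}\otimes e_3+e_4\otimes a_{22}+a_{22}\otimes e_4,$$ $\epsilon(e_1)=1$,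 $\epsilon(e_2)=\epsilon(e_3)=\epsilon(e_4)=0$, $\epsilon(a_{ij})=0$, $S(e_i)=e_i$, $S(a_{ij})=a_{ji}$. **Definitions.** Let $A$ be a semisimple Hopf algebra, with Sweedler notation $\Delta(a)=a_{(1)}\otimes a_{(2)}$. A unital left coideal subalgebra of $A$ is a unital subalgebra $L\subseteq A$ with $\Delta(L)\subseteq A\otimes L$; it is normal if $a_{(1)}\,x\,S(a_{(2)})\in L$ for all $a\in A$, $x\in L$. An integral of $L$ is a nonzero element $l\in L$ with $lx=xl=\epsilon(x)l$ for all $x\in L$ (unique up to a nonzero scalar). $Z(\cdot)$ denotes the center of an algebra. $A$ is nilpotent if it has a chain of normal unital left coideal subalgebras $\mathbb{C}1=L_0\subset L_1\subset\cdots\subset L_i=A$ such that $L_{j+1}l_j\subset Z(Al_j)$ for all $0\le j\le i-1$, where $l_j$ is the integral of $L_j$ and $Al_j=\{al_j: a\in A\}$. *)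

theory Defs
  imports "HOL-Analysis.Analysis"
begin

section \<open>Tensor products in coordinates\<close>

text \<open>
  Finite-dimensional complex vector spaces are given in coordinates, as \<open>complex ^ 'n\<close> with an
  arbitrary finite index type; linear algebra over the complex numbers is that of the library for
  the scalar multiplication \<open>*s\<close> (\<open>vec.span\<close>, \<open>vec.subspace\<close>, \<open>Vector_Spaces.linear\<close>).  The
  tensor product of \<open>complex ^ 'm\<close> and \<open>complex ^ 'n\<close> is \<open>complex ^ ('m \<times> 'n)\<close>.
  The componentwise ring multiplication that the library puts on \<open>complex ^ 'n\<close> is never used.
\<close>

definition tensor :: "complex ^ 'm \<Rightarrow> complex ^ 'n \<Rightarrow> complex ^ ('m \<times> 'n)" (infixr "\<otimes>" 75)
  where "u \<otimes> v = (\<chi> p. u $ fst p * v $ snd p)"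

text \<open>
  \<open>tensor_lift B\<close> is the linear map induced on the tensor product by a bilinear map \<open>B\<close>.  With
  it Sweedler notation becomes \<open>B(a\<^sub>(\<^sub>1\<^sub>), a\<^sub>(\<^sub>2\<^sub>)) = tensor_lift B (comult H a)\<close>.
\<close>

definition tensor_lift ::
  "(complex ^ 'm \<Rightarrow> complex ^ 'n \<Rightarrow> complex ^ 'k) \<Rightarrow> complex ^ ('m \<times> 'n) \<Rightarrow> complex ^ 'k"
  where "tensor_lift B t = (\<Sum>i\<in>UNIV. \<Sum>j\<in>UNIV. (t $ (i, j)) *s B (axis i 1) (axis j 1))"

definition bilinear_map ::
  "(complex ^ 'm \<Rightarrow> complex ^ 'n \<Rightarrow> complex ^ 'k) \<Rightarrow> bool"
  where "bilinear_map B \<longleftrightarrow>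
    (\<forall>u. Vector_Spaces.linear (*s) (*s) (B u)) \<and>
    (\<forall>v. Vector_Spaces.linear (*s) (*s) (\<lambda>u. B u v))"

lemma tensor_lift_tensor:
  assumes "bilinear_map B"
  shows "tensor_lift B (u \<otimes> v) = B u v"
proof -
  have l1: "module_hom (*s) (*s) (\<lambda>u. B u v)"
    and l2: "module_hom (*s) (*s) (B u)" for u v
    using assms by (auto simp: bilinear_map_def linear_iff_module_hom)
  have "B u v = B (\<Sum>i\<in>UNIV. u $ i *s axis i 1) v"
    by (simp add: basis_expansion)
  also have "\<dots> = (\<Sum>i\<in>UNIV. u $ i *s B (axis i 1) v)"
    by (simp add: module_hom.sum[OF l1] module_hom.scale[OF l1])
  also have "\<dots> = (\<Sum>i\<in>UNIV. u $ i *s B (axis i 1) (\<Sum>j\<in>UNIV. v $ j *s axis j 1))"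
    by (simp add: basis_expansion)
  also have "\<dots> = (\<Sum>i\<in>UNIV. \<Sum>j\<in>UNIV. (u $ i * v $ j) *s B (axis i 1) (axis j 1))"
    by (simp add: module_hom.sum[OF l2] module_hom.scale[OF l2] vec.scale_sum_right)
  finally show ?thesis
    by (simp add: tensor_lift_def tensor_def)
qed

section \<open>Semisimple Hopf algebras\<close>

record ('n::finite) hopf_data =
  hmult :: "complex ^ 'n \<Rightarrow> complex ^ 'n \<Rightarrow> complex ^ 'n"
  hone :: "complex ^ 'n"
  comult :: "complex ^ 'n \<Rightarrow> complex ^ ('n \<times> 'n)"
  counit :: "complex ^ 'n \<Rightarrow> complex"
  antipode :: "complex ^ 'n \<Rightarrow> complex ^ 'n"

definition tensor_mult ::
  "('n::finite) hopf_data \<Rightarrow> complex ^ ('n \<times> 'n) \<Rightarrow> complex ^ ('n \<times> 'n) \<Rightarrow> complex ^ ('n \<times> 'n)"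
  where "tensor_mult H s t =
    tensor_lift (\<lambda>a b. tensor_lift (\<lambda>c d. hmult H a c \<otimes> hmult H b d) t) s"

locale unital_algebra =
  fixes H :: "('n::finite) hopf_data"
  assumes mult_bilinear: "bilinear_map (hmult H)"
    and mult_assoc: "hmult H (hmult H a b) c = hmult H a (hmult H b c)"
    and one_left: "hmult H (hone H) a = a"
    and one_right: "hmult H a (hone H) = a"

text \<open>
  In \<open>coassoc\<close> the two sides lie in \<open>complex ^ (('n \<times> 'n) \<times> 'n)\<close> and \<open>complex ^ ('n \<times> 'n \<times> 'n)\<close>,
  which are identified by reassociating the indices.
\<close>

locale hopf_algebra = unital_algebra H for H :: "('n::finite) hopf_data" +
  assumes comult_linear: "Vector_Spaces.linear (*s) (*s) (comult H)"
    and counit_linear: "Vector_Spaces.linear (*s) (*) (counit H)"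
    and antipode_linear: "Vector_Spaces.linear (*s) (*s) (antipode H)"
    and coassoc: "tensor_lift (\<lambda>u v. comult H u \<otimes> v) (comult H a) $ ((i, j), k) =
      tensor_lift (\<lambda>u v. u \<otimes> comult H v) (comult H a) $ (i, (j, k))"
    and counit_left: "tensor_lift (\<lambda>u v. counit H u *s v) (comult H a) = a"
    and counit_right: "tensor_lift (\<lambda>u v. counit H v *s u) (comult H a) = a"
    and comult_mult: "comult H (hmult H a b) = tensor_mult H (comult H a) (comult H b)"
    and comult_one: "comult H (hone H) = hone H \<otimes> hone H"
    and counit_mult: "counit H (hmult H a b) = counit H a * counit H b"
    and counit_one: "counit H (hone H) = 1"
    and antipode_left:
      "tensor_lift (\<lambda>u v. hmult H (antipode H u) v) (comult H a) = counit H a *s hone H"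
    and antipode_right:
      "tensor_lift (\<lambda>u v. hmult H u (antipode H v)) (comult H a) = counit H a *s hone H"

definition left_ideal :: "('n::finite) hopf_data \<Rightarrow> (complex ^ 'n) set \<Rightarrow> bool"
  where "left_ideal H I \<longleftrightarrow> vec.subspace I \<and> (\<forall>a. \<forall>x\<in>I. hmult H a x \<in> I)"

text \<open>Semisimplicity: the regular left module is completely reducible.\<close>

locale semisimple_hopf_algebra = hopf_algebra +
  assumes semisimple: "left_ideal H I \<Longrightarrow>
    \<exists>J. left_ideal H J \<and> I \<inter> J = {0} \<and> {x + y | x y. x \<in> I \<and> y \<in> J} = UNIV"

section \<open>Nilpotency\<close>

definition unital_subalgebra :: "('n::finite) hopf_data \<Rightarrow> (complex ^ 'n) set \<Rightarrow> bool"
  where "unital_subalgebra H L \<longleftrightarrow>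
    vec.subspace L \<and> hone H \<in> L \<and> (\<forall>x\<in>L. \<forall>y\<in>L. hmult H x y \<in> L)"

definition left_coideal_subalgebra :: "('n::finite) hopf_data \<Rightarrow> (complex ^ 'n) set \<Rightarrow> bool"
  where "left_coideal_subalgebra H L \<longleftrightarrow>
    unital_subalgebra H L \<and> comult H ` L \<subseteq> vec.span {a \<otimes> x | a x. x \<in> L}"

definition normal_left_coideal_subalgebra :: "('n::finite) hopf_data \<Rightarrow> (complex ^ 'n) set \<Rightarrow> bool"
  where "normal_left_coideal_subalgebra H L \<longleftrightarrow>
    left_coideal_subalgebra H L \<and>
    (\<forall>a. \<forall>x\<in>L.
      tensor_lift (\<lambda>u v. hmult H (hmult H u x) (antipode H v)) (comult H a) \<in> L)"

definition is_integral :: "('n::finite) hopf_data \<Rightarrow> (complex ^ 'n) set \<Rightarrow> complex ^ 'n \<Rightarrow> bool"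
  where "is_integral H L l \<longleftrightarrow> l \<in> L \<and> l \<noteq> 0 \<and>
    (\<forall>x\<in>L. hmult H l x = counit H x *s l \<and> hmult H x l = counit H x *s l)"

definition center_of :: "('n::finite) hopf_data \<Rightarrow> (complex ^ 'n) set \<Rightarrow> (complex ^ 'n) set"
  where "center_of H B = {z \<in> B. \<forall>b\<in>B. hmult H z b = hmult H b z}"

definition right_translate ::
  "('n::finite) hopf_data \<Rightarrow> (complex ^ 'n) set \<Rightarrow> complex ^ 'n \<Rightarrow> (complex ^ 'n) set"
  where "right_translate H X l = {hmult H x l | x. x \<in> X}"

text \<open>
  The chain is required to be strictly increasing.  This is no restriction, since repeated terms of
  a weakly increasing chain may be dropped.  The inclusion in the centre is not strict.
\<close>

definition nilpotent :: "('n::finite) hopf_data \<Rightarrow> bool"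
  where "nilpotent H \<longleftrightarrow>
    (\<exists>(i::nat) (L :: nat \<Rightarrow> (complex ^ 'n) set) (l :: nat \<Rightarrow> complex ^ 'n).
      L 0 = {c *s hone H | c. True} \<and> L i = UNIV \<and>
      (\<forall>j\<le>i. normal_left_coideal_subalgebra H (L j)) \<and>
      (\<forall>j<i. L j \<subset> L (Suc j)) \<and>
      (\<forall>j<i. is_integral H (L j) (l j) \<and>
        right_translate H (L (Suc j)) (l j) \<subseteq> center_of H (right_translate H UNIV (l j))))"

section \<open>The Kac--Paljutkin algebra\<close>

text \<open>
  The basis of \<open>\<complex> \<oplus> \<complex> \<oplus> \<complex> \<oplus> \<complex> \<oplus> M\<^sub>2\<close>: \<open>E1, \<dots>, E4\<close> index the units of the one-dimensional
  summands and \<open>A11, \<dots>, A22\<close> the matrix units.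
\<close>

datatype kp_index = E1 | E2 | E3 | E4 | A11 | A12 | A21 | A22

lemma UNIV_kp_index: "UNIV = {E1, E2, E3, E4, A11, A12, A21, A22}"
proof -
  have "x \<in> {E1, E2, E3, E4, A11, A12, A21, A22}" for x
    by (cases x) simp_all
  then show ?thesis by blast
qed

instance kp_index :: finite
  by standard (simp add: UNIV_kp_index)

type_synonym kp = "complex ^ kp_index"

abbreviation kp_basis :: "kp_index \<Rightarrow> kp" ("\<b>")
  where "\<b> k \<equiv> axis k 1"

definition kp_extend :: "(kp_index \<Rightarrow> complex ^ 'm) \<Rightarrow> kp \<Rightarrow> complex ^ 'm"
  where "kp_extend f x = (\<Sum>k\<in>UNIV. x $ k *s f k)"

definition kp_mult :: "kp \<Rightarrow> kp \<Rightarrow> kp"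
  where "kp_mult x y = (\<chi> k. case k of
      E1 \<Rightarrow> x $ E1 * y $ E1
    | E2 \<Rightarrow> x $ E2 * y $ E2
    | E3 \<Rightarrow> x $ E3 * y $ E3
    | E4 \<Rightarrow> x $ E4 * y $ E4
    | A11 \<Rightarrow> x $ A11 * y $ A11 + x $ A12 * y $ A21
    | A12 \<Rightarrow> x $ A11 * y $ A12 + x $ A12 * y $ A22
    | A21 \<Rightarrow> x $ A21 * y $ A11 + x $ A22 * y $ A21
    | A22 \<Rightarrow> x $ A21 * y $ A12 + x $ A22 * y $ A22)"

definition kp_one :: kp
  where "kp_one = \<b> E1 + \<b> E2 + \<b> E3 + \<b> E4 + \<b> A11 + \<b> A22"

fun kp_comult_basis :: "kp_index \<Rightarrow> complex ^ (kp_index \<times> kp_index)"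
  where
    "kp_comult_basis E1 =
      \<b> E1 \<otimes> \<b> E1 + \<b> E2 \<otimes> \<b> E2 + \<b> E3 \<otimes> \<b> E3 + \<b> E4 \<otimes> \<b> E4
      + (1/2) *s (\<b> A11 \<otimes> \<b> A11 + \<b> A12 \<otimes> \<b> A12 + \<b> A21 \<otimes> \<b> A21 + \<b> A22 \<otimes> \<b> A22)"
  | "kp_comult_basis E2 =
      \<b> E1 \<otimes> \<b> E2 + \<b> E2 \<otimes> \<b> E1 + \<b> E3 \<otimes> \<b> E4 + \<b> E4 \<otimes> \<b> E3
      + (1/2) *s (\<b> A11 \<otimes> \<b> A22) + (1/2) *s (\<b> A22 \<otimes> \<b> A11)
      - (\<i>/2) *s (\<b> A12 \<otimes> \<b> A21) + (\<i>/2) *s (\<b> A21 \<otimes> \<b> A12)"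
  | "kp_comult_basis E3 =
      \<b> E1 \<otimes> \<b> E3 + \<b> E3 \<otimes> \<b> E1 + \<b> E2 \<otimes> \<b> E4 + \<b> E4 \<otimes> \<b> E2
      + (1/2) *s (\<b> A11 \<otimes> \<b> A22) + (1/2) *s (\<b> A22 \<otimes> \<b> A11)
      + (\<i>/2) *s (\<b> A12 \<otimes> \<b> A21) - (\<i>/2) *s (\<b> A21 \<otimes> \<b> A12)"
  | "kp_comult_basis E4 =
      \<b> E1 \<otimes> \<b> E4 + \<b> E4 \<otimes> \<b> E1 + \<b> E2 \<otimes> \<b> E3 + \<b> E3 \<otimes> \<b> E2
      + (1/2) *s (\<b> A11 \<otimes> \<b> A11) + (1/2) *s (\<b> A22 \<otimes> \<b> A22)
      - (1/2) *s (\<b> A12 \<otimes> \<b> A12) - (1/2) *s (\<b> A21 \<otimes> \<b> A21)"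
  | "kp_comult_basis A11 =
      \<b> E1 \<otimes> \<b> A11 + \<b> A11 \<otimes> \<b> E1 + \<b> E2 \<otimes> \<b> A22 + \<b> A22 \<otimes> \<b> E2
      + \<b> E3 \<otimes> \<b> A22 + \<b> A22 \<otimes> \<b> E3 + \<b> E4 \<otimes> \<b> A11 + \<b> A11 \<otimes> \<b> E4"
  | "kp_comult_basis A12 =
      \<b> E1 \<otimes> \<b> A12 + \<b> A12 \<otimes> \<b> E1 + \<i> *s (\<b> E2 \<otimes> \<b> A21) - \<i> *s (\<b> A21 \<otimes> \<b> E2)
      - \<i> *s (\<b> E3 \<otimes> \<b> A21) + \<i> *s (\<b> A21 \<otimes> \<b> E3) - \<b> E4 \<otimes> \<b> A12 - \<b> A12 \<otimes> \<b> E4"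
  | "kp_comult_basis A21 =
      \<b> E1 \<otimes> \<b> A21 + \<b> A21 \<otimes> \<b> E1 - \<i> *s (\<b> E2 \<otimes> \<b> A12) + \<i> *s (\<b> A12 \<otimes> \<b> E2)
      + \<i> *s (\<b> E3 \<otimes> \<b> A12) - \<i> *s (\<b> A12 \<otimes> \<b> E3) - \<b> E4 \<otimes> \<b> A21 - \<b> A21 \<otimes> \<b> E4"
  | "kp_comult_basis A22 =
      \<b> E1 \<otimes> \<b> A22 + \<b> A22 \<otimes> \<b> E1 + \<b> E2 \<otimes> \<b> A11 + \<b> A11 \<otimes> \<b> E2
      + \<b> E3 \<otimes> \<b> A11 + \<b> A11 \<otimes> \<b> E3 + \<b> E4 \<otimes> \<b> A22 + \<b> A22 \<otimes> \<b> E4"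

fun kp_antipode_basis :: "kp_index \<Rightarrow> kp"
  where
    "kp_antipode_basis A12 = \<b> A21"
  | "kp_antipode_basis A21 = \<b> A12"
  | "kp_antipode_basis k = \<b> k"

definition kac_paljutkin :: "kp_index hopf_data"
  where "kac_paljutkin = \<lparr>
    hmult = kp_mult,
    hone = kp_one,
    comult = kp_extend kp_comult_basis,
    counit = (\<lambda>x. x $ E1),
    antipode = kp_extend kp_antipode_basis\<rparr>"

end

(* Semisimplicity is Weyl's unitary trick: the adjoint of left multiplication by a is left
   multiplication by a^*, so the orthogonal complement of a left ideal is a left ideal (the real
   inner product suffices, as left ideals are complex subspaces).  Nilpotency: with e the unit of
   the commutative part and f the unit of the matrix part, the span L of e and f is a central left
   coideal subalgebra with integral e, and A e is the commutative algebra C^4, so the chain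
   C1, L, A works. *)

theory Submission
  imports Defs
begin

section \<open>Maps on tensor products\<close>

lemma linear_cartI:
  fixes f :: "complex ^ 'm \<Rightarrow> complex ^ 'n"
  assumes "\<And>x y. f (x + y) = f x + f y" "\<And>c x. f (c *s x) = c *s f x"
  shows "Vector_Spaces.linear (*s) (*s) f"
  using assms by (simp add: Vector_Spaces.linear_iff vec.vector_space_axioms)

lemma linear_tensor_lift:
  assumes "Vector_Spaces.linear (*s) (*s) f"
  shows "f (tensor_lift B t) = tensor_lift (\<lambda>u v. f (B u v)) t"
proof -
  have "module_hom (*s) (*s) f"
    using assms by (simp add: linear_iff_module_hom)
  then show ?thesis
    by (simp add: tensor_lift_def module_hom.sum module_hom.scale)
qed

text \<open>Expanding a tensor in the elementary tensors of basis vectors gives back the tensor, so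
  \<open>tensor_lift\<close> applied to \<otimes> itself is the identity. This is what makes the
  whole algebra a left coideal.\<close>

lemma span_tensors:
  fixes t :: "complex ^ ('m::finite \<times> 'n::finite)"
  shows "t \<in> vec.span {a \<otimes> x | a x. True}"
proof -
  have "tensor_lift (\<otimes>) t $ (k, l) = t $ (k, l)" for k l
  proof -
    have "tensor_lift (\<otimes>) t $ (k, l) =
        (\<Sum>i\<in>UNIV. \<Sum>j\<in>UNIV. if j = l then if i = k then t $ (i, j) else 0 else 0)"
      unfolding tensor_lift_def tensor_def sum_component
      by (intro sum.cong refl) (auto simp: axis_def)
    then show ?thesis by simp
  qed
  then have "tensor_lift (\<otimes>) t = t"
    by (simp add: vec_eq_iff)
  moreover have "tensor_lift (\<otimes>) t \<in> vec.span {a \<otimes> x | a x. True}"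
    unfolding tensor_lift_def
    by (intro vec.span_sum vec.span_scale vec.span_base) blast
  ultimately show ?thesis by simp
qed

text \<open>The untouched tensor factor is a basis vector, which collapses one of the two sums in
  \<open>tensor_lift\<close>. With its mirror image below, each side of coassociativity becomes a
  single sum over the basis.\<close>

lemma tensor_lift_map_left:
  "tensor_lift (\<lambda>u v. f u \<otimes> v) t $ (a, k) = (\<Sum>p\<in>UNIV. t $ (p, k) * f (axis p 1) $ a)"
proof -
  have "tensor_lift (\<lambda>u v. f u \<otimes> v) t $ (a, k) =
      (\<Sum>p\<in>UNIV. \<Sum>q\<in>UNIV. if q = k then t $ (p, q) * f (axis p 1) $ a else 0)"
    unfolding tensor_lift_def tensor_def sum_component
    by (intro sum.cong refl) (auto simp: axis_def)
  then show ?thesis by simp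
qed

lemma tensor_lift_map_right:
  "tensor_lift (\<lambda>u v. u \<otimes> f v) t $ (i, a) = (\<Sum>q\<in>UNIV. t $ (i, q) * f (axis q 1) $ a)"
proof -
  have "tensor_lift (\<lambda>u v. u \<otimes> f v) t $ (i, a) =
      (\<Sum>q\<in>UNIV. \<Sum>p\<in>UNIV. if p = i then t $ (p, q) * f (axis q 1) $ a else 0)"
    unfolding tensor_lift_def tensor_def sum_component
    by (subst sum.swap, intro sum.cong refl) (auto simp: axis_def)
  then show ?thesis by simp
qed

section \<open>Hopf algebras with a central coideal subalgebra\<close>

context hopf_algebra
begin

lemma mult_linear:
  shows "Vector_Spaces.linear (*s) (*s) (hmult H a)"
    and "Vector_Spaces.linear (*s) (*s) (\<lambda>u. hmult H u b)"
  using mult_bilinear by (auto simp: bilinear_map_def)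

lemma mult_scale_left: "hmult H (c *s a) b = c *s hmult H a b"
  and mult_scale_right: "hmult H a (c *s b) = c *s hmult H a b"
  using mult_linear by (auto simp: Vector_Spaces.linear_iff)

lemma counit_scale: "counit H (c *s a) = c * counit H a"
  using counit_linear by (auto simp: Vector_Spaces.linear_iff)

lemma comult_scale: "comult H (c *s a) = c *s comult H a"
  using comult_linear by (auto simp: Vector_Spaces.linear_iff)

text \<open>A central \<open>x\<close> can be pulled in front of the Sweedler sum, and what remains
  is the antipode identity. The adjoint action on \<open>L\<close> is therefore multiplication by
  the counit, which preserves any subspace.\<close>

lemma normal_if_central:
  assumes L: "left_coideal_subalgebra H L"
    and central: "\<And>a x. x \<in> L \<Longrightarrow> hmult H x a = hmult H a x"
  shows "normal_left_coideal_subalgebra H L"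
  unfolding normal_left_coideal_subalgebra_def
proof (intro conjI allI ballI L)
  fix a x assume x: "x \<in> L"
  have "tensor_lift (\<lambda>u v. hmult H (hmult H u x) (antipode H v)) (comult H a) =
      tensor_lift (\<lambda>u v. hmult H x (hmult H u (antipode H v))) (comult H a)"
    by (simp add: central[OF x, symmetric] mult_assoc)
  also have "\<dots> = hmult H x (counit H a *s hone H)"
    by (simp add: antipode_right flip: linear_tensor_lift[OF mult_linear(1)])
  also have "\<dots> = counit H a *s x"
    by (simp add: mult_scale_right one_right)
  finally show "tensor_lift (\<lambda>u v. hmult H (hmult H u x) (antipode H v)) (comult H a) \<in> L"
    using L x by (simp add: left_coideal_subalgebra_def unital_subalgebra_def vec.subspace_scale)
qed

lemma left_coideal_subalgebra_scalars: "left_coideal_subalgebra H {c *s hone H | c. True}"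
proof -
  let ?S = "{c *s hone H | c. True}"
  have one: "hone H \<in> ?S"
    by (auto intro!: exI[of _ "1::complex"])
  have "?S = vec.span {hone H}"
    by (auto simp: vec.span_singleton)
  then have "vec.subspace ?S"
    by simp
  moreover have "comult H (c *s hone H) \<in> vec.span {a \<otimes> x | a x. x \<in> ?S}" for c
    unfolding comult_scale comult_one
    by (intro vec.span_scale vec.span_base) (use one in blast)
  ultimately show ?thesis
    using one
    by (auto simp: left_coideal_subalgebra_def unital_subalgebra_def mult_scale_left one_left)
qed

lemma normal_UNIV: "normal_left_coideal_subalgebra H UNIV"
  using span_tensors
  by (auto simp: normal_left_coideal_subalgebra_def left_coideal_subalgebra_def
      unital_subalgebra_def vec.subspace_UNIV)

lemma is_integral_scalars: "is_integral H {c *s hone H | c. True} (hone H)"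
proof -
  have "hone H \<noteq> 0"
    using counit_one counit_scale[of 0 "hone H"] by auto
  then show ?thesis
    by (auto simp: is_integral_def mult_scale_left mult_scale_right one_left counit_scale
        counit_one intro!: exI[of _ "1::complex"])
qed

text \<open>For the chain C1, \<open>L\<close>, A only two conditions have to be met. At the bottom
  the integral is 1, so the condition says that \<open>L\<close> is central in A. At
  \<open>L\<close> it says that the algebra of the elements a\<open>l\<close> is
  commutative.\<close>

lemma nilpotent_if_central_extension:
  assumes L: "left_coideal_subalgebra H L" and integral: "is_integral H L l"
    and central: "\<And>a x. x \<in> L \<Longrightarrow> hmult H x a = hmult H a x"
    and commute: "\<And>a b. hmult H (hmult H a l) (hmult H b l) = hmult H (hmult H b l) (hmult H a l)"
    and proper: "L \<noteq> {c *s hone H | c. True}" "L \<noteq> UNIV"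
  shows "nilpotent H"
proof -
  define S where "S = {c *s hone H | c. True}"
  \<comment> \<open>From index 2 on the chain is constantly the whole algebra, so normality holds
    for all \<open>j\<close> at once. Strict inclusions and integrals concern only
    \<open>j < 2\<close>.\<close>
  define M where "M = (\<lambda>j::nat. if j = 0 then S else if j = 1 then L else UNIV)"
  define m where "m = (\<lambda>j::nat. if j = 0 then hone H else l)"
  have normal: "normal_left_coideal_subalgebra H (M j)" for j
  proof -
    have "normal_left_coideal_subalgebra H S"
      unfolding S_def
      by (rule normal_if_central[OF left_coideal_subalgebra_scalars])
        (auto simp: mult_scale_left mult_scale_right one_left one_right)
    then show ?thesis
      using normal_if_central[OF L central] normal_UNIV by (simp add: M_def)
  qed
  have "S \<subseteq> L"
    using L by (auto simp: S_def left_coideal_subalgebra_def unital_subalgebra_def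
        vec.subspace_scale)
  then have increasing: "M j \<subset> M (Suc j)" if "j < 2" for j
    using proper that by (auto simp: M_def S_def less_2_cases_iff)
  have steps: "is_integral H (M j) (m j) \<and>
      right_translate H (M (Suc j)) (m j) \<subseteq> center_of H (right_translate H UNIV (m j))"
    if "j < 2" for j
  proof -
    have "right_translate H X (hone H) = X" for X
      by (auto simp: right_translate_def one_right)
    then have "right_translate H L (hone H) \<subseteq> center_of H (right_translate H UNIV (hone H))"
      using central by (auto simp: center_of_def)
    moreover have "right_translate H UNIV l \<subseteq> center_of H (right_translate H UNIV l)"
      using commute by (auto simp: center_of_def right_translate_def)
    ultimately show ?thesis
      using that integral is_integral_scalars
      by (auto simp: M_def S_def m_def less_2_cases_iff)
  qed
  show ?thesis
    unfolding nilpotent_def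
    by (rule exI[of _ 2], rule exI[of _ M], rule exI[of _ m])
      (use normal increasing steps in \<open>auto simp: M_def S_def\<close>)
qed

end

section \<open>The Kac--Paljutkin algebra\<close>

lemma sum_kp_index:
  "(\<Sum>k\<in>UNIV. f k) = f E1 + f E2 + f E3 + f E4 + f A11 + f A12 + f A21 + f A22"
  for f :: "kp_index \<Rightarrow> 'a::comm_monoid_add"
  by (simp add: UNIV_kp_index add_ac)

lemma forall_kp_index: "(\<forall>k. P k) \<longleftrightarrow> P E1 \<and> P E2 \<and> P E3 \<and> P E4 \<and> P A11 \<and> P A12 \<and> P A21 \<and> P A22"
  by (metis kp_index.exhaust)

text \<open>This is the comultiplication table transposed: the entry at \<open>(p, q)\<close>, as a
  functional of \<open>x\<close>, is the product of the dual basis vectors \<open>p\<close> and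
  \<open>q\<close> in the dual algebra. The axioms involving the comultiplication thereby reduce to
  finite case checks.\<close>

lemma kp_comult_nth:
  "kp_extend kp_comult_basis x $ (p, q) = (case p of
      E1 \<Rightarrow> x $ q
    | E2 \<Rightarrow> (case q of E1 \<Rightarrow> x $ E2 | E2 \<Rightarrow> x $ E1 | E3 \<Rightarrow> x $ E4 | E4 \<Rightarrow> x $ E3
        | A11 \<Rightarrow> x $ A22 | A12 \<Rightarrow> - \<i> * x $ A21 | A21 \<Rightarrow> \<i> * x $ A12 | A22 \<Rightarrow> x $ A11)
    | E3 \<Rightarrow> (case q of E1 \<Rightarrow> x $ E3 | E2 \<Rightarrow> x $ E4 | E3 \<Rightarrow> x $ E1 | E4 \<Rightarrow> x $ E2
        | A11 \<Rightarrow> x $ A22 | A12 \<Rightarrow> \<i> * x $ A21 | A21 \<Rightarrow> - \<i> * x $ A12 | A22 \<Rightarrow> x $ A11)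
    | E4 \<Rightarrow> (case q of E1 \<Rightarrow> x $ E4 | E2 \<Rightarrow> x $ E3 | E3 \<Rightarrow> x $ E2 | E4 \<Rightarrow> x $ E1
        | A11 \<Rightarrow> x $ A11 | A12 \<Rightarrow> - x $ A12 | A21 \<Rightarrow> - x $ A21 | A22 \<Rightarrow> x $ A22)
    | A11 \<Rightarrow> (case q of E1 \<Rightarrow> x $ A11 | E2 \<Rightarrow> x $ A22 | E3 \<Rightarrow> x $ A22 | E4 \<Rightarrow> x $ A11
        | A11 \<Rightarrow> (x $ E1 + x $ E4) / 2 | A12 \<Rightarrow> 0 | A21 \<Rightarrow> 0 | A22 \<Rightarrow> (x $ E2 + x $ E3) / 2)
    | A12 \<Rightarrow> (case q of E1 \<Rightarrow> x $ A12 | E2 \<Rightarrow> \<i> * x $ A21 | E3 \<Rightarrow> - \<i> * x $ A21 | E4 \<Rightarrow> - x $ A12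
        | A11 \<Rightarrow> 0 | A12 \<Rightarrow> (x $ E1 - x $ E4) / 2 | A21 \<Rightarrow> \<i> * (x $ E3 - x $ E2) / 2 | A22 \<Rightarrow> 0)
    | A21 \<Rightarrow> (case q of E1 \<Rightarrow> x $ A21 | E2 \<Rightarrow> - \<i> * x $ A12 | E3 \<Rightarrow> \<i> * x $ A12 | E4 \<Rightarrow> - x $ A21
        | A11 \<Rightarrow> 0 | A12 \<Rightarrow> \<i> * (x $ E2 - x $ E3) / 2 | A21 \<Rightarrow> (x $ E1 - x $ E4) / 2 | A22 \<Rightarrow> 0)
    | A22 \<Rightarrow> (case q of E1 \<Rightarrow> x $ A22 | E2 \<Rightarrow> x $ A11 | E3 \<Rightarrow> x $ A11 | E4 \<Rightarrow> x $ A22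
        | A11 \<Rightarrow> (x $ E2 + x $ E3) / 2 | A12 \<Rightarrow> 0 | A21 \<Rightarrow> 0 | A22 \<Rightarrow> (x $ E1 + x $ E4) / 2))"
  by (cases p; cases q; simp add: kp_extend_def sum_kp_index tensor_def axis_def field_simps)

lemma kp_antipode_nth:
  "kp_extend kp_antipode_basis x $ k = (case k of A12 \<Rightarrow> x $ A21 | A21 \<Rightarrow> x $ A12 | _ \<Rightarrow> x $ k)"
  by (cases k) (simp_all add: kp_extend_def sum_kp_index axis_def)

lemma kp_extend_linear: "Vector_Spaces.linear (*s) (*s) (kp_extend f)"
  by (rule linear_cartI)
    (simp_all add: kp_extend_def vec.scale_left_distrib sum.distrib vec.scale_sum_right)

lemma kp_mult_bilinear: "bilinear_map kp_mult"
  unfolding bilinear_map_def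
  by (intro conjI allI linear_cartI)
    (simp_all add: kp_mult_def vec_eq_iff algebra_simps split: kp_index.split)

text \<open>These are the pairs of basis elements whose product is the basis element
  \<open>k\<close>. Since every product of basis elements is zero or a basis element, they encode
  all structure constants.\<close>

fun kp_factors :: "kp_index \<Rightarrow> (kp_index \<times> kp_index) set"
  where
    "kp_factors A11 = {(A11, A11), (A12, A21)}"
  | "kp_factors A12 = {(A11, A12), (A12, A22)}"
  | "kp_factors A21 = {(A21, A11), (A22, A21)}"
  | "kp_factors A22 = {(A21, A12), (A22, A22)}"
  | "kp_factors k = {(k, k)}"

lemma kp_mult_nth:
  "kp_mult x y $ k = (\<Sum>(p, q) \<in> kp_factors k. x $ p * y $ q)"
  by (cases k) (simp_all add: kp_mult_def)

lemma sum_indicator_pairs: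
  fixes g :: "'a::finite \<Rightarrow> 'a \<Rightarrow> complex"
  shows "(\<Sum>i\<in>UNIV. \<Sum>m\<in>UNIV. if (i, m) \<in> F then g i m else 0) = (\<Sum>(i, m) \<in> F. g i m)"
proof -
  have "(\<Sum>i\<in>UNIV. \<Sum>m\<in>UNIV. if (i, m) \<in> F then g i m else 0) =
      (\<Sum>p\<in>UNIV. if p \<in> F then case p of (i, m) \<Rightarrow> g i m else 0)"
    unfolding sum.cartesian_product UNIV_Times_UNIV by (intro sum.cong refl) auto
  also have "\<dots> = (\<Sum>(i, m) \<in> F. g i m)"
    using sum.inter_restrict[of UNIV "\<lambda>p. case p of (i, m) \<Rightarrow> g i m" F] by simp
  finally show ?thesis .
qed

lemma kp_mult_basis: "kp_mult (\<b> i) (\<b> m) $ k = (if (i, m) \<in> kp_factors k then 1 else 0)"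
proof -
  have "kp_mult (\<b> i) (\<b> m) $ k = (\<Sum>p \<in> kp_factors k. if p = (i, m) then 1 else 0)"
    unfolding kp_mult_nth by (intro sum.cong) (auto simp: axis_def split: if_splits)
  then show ?thesis by simp
qed

text \<open>By definition the product on the tensor square is a sum over all quadruples of indices.
  Keeping only the pairs that multiply to \<open>k\<close> and to \<open>l\<close> leaves at most
  four terms, so that multiplicativity of the comultiplication can be checked entry by
  entry.\<close>

lemma kp_tensor_mult_nth:
  "tensor_mult kac_paljutkin s t $ (k, l) =
    (\<Sum>(i, m) \<in> kp_factors k. \<Sum>(j, n) \<in> kp_factors l. s $ (i, j) * t $ (m, n))"
proof -
  have "tensor_mult kac_paljutkin s t $ (k, l) =
      (\<Sum>i\<in>UNIV. \<Sum>j\<in>UNIV. \<Sum>m\<in>UNIV. \<Sum>n\<in>UNIV.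
        if (i, m) \<in> kp_factors k then if (j, n) \<in> kp_factors l then s $ (i, j) * t $ (m, n) else 0 else 0)"
    unfolding tensor_mult_def tensor_lift_def sum_component vector_smult_component sum_distrib_left
    by (intro sum.cong refl) (simp add: tensor_def kac_paljutkin_def kp_mult_basis)
  also have "\<dots> = (\<Sum>i\<in>UNIV. \<Sum>m\<in>UNIV. if (i, m) \<in> kp_factors k then
      (\<Sum>j\<in>UNIV. \<Sum>n\<in>UNIV. if (j, n) \<in> kp_factors l then s $ (i, j) * t $ (m, n) else 0) else 0)"
    \<comment> \<open>Exchanging the sums over \<open>j\<close> and \<open>m\<close> brings together
      \<open>i\<close> and \<open>m\<close>, the indices of the left tensor factors, and so
      separates the two conditions.\<close>
    by (subst sum.swap[of _ UNIV UNIV], intro sum.cong refl) auto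
  also have "\<dots> = (\<Sum>(i, m) \<in> kp_factors k. \<Sum>(j, n) \<in> kp_factors l. s $ (i, j) * t $ (m, n))"
    unfolding sum_indicator_pairs by simp
  finally show ?thesis .
qed

section \<open>Verification of the Hopf algebra axioms\<close>

lemma kp_coassoc:
  "tensor_lift (\<lambda>u v. kp_extend kp_comult_basis u \<otimes> v) (kp_extend kp_comult_basis x) $ ((i, j), k) =
   tensor_lift (\<lambda>u v. u \<otimes> kp_extend kp_comult_basis v) (kp_extend kp_comult_basis x) $ (i, (j, k))"
  unfolding tensor_lift_map_left tensor_lift_map_right sum_kp_index kp_comult_nth
  by (cases i; cases j; cases k; simp add: axis_def field_simps)

lemma kp_comult_mult:
  "kp_extend kp_comult_basis (kp_mult x y) =
    tensor_mult kac_paljutkin (kp_extend kp_comult_basis x) (kp_extend kp_comult_basis y)"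
proof -
  have "kp_extend kp_comult_basis (kp_mult x y) $ (k, l) =
    tensor_mult kac_paljutkin (kp_extend kp_comult_basis x) (kp_extend kp_comult_basis y) $ (k, l)" for k l
    unfolding kp_tensor_mult_nth kp_comult_nth
    by (cases k; cases l; simp add: kp_mult_def; simp add: field_simps)
  then show ?thesis by (simp add: vec_eq_iff)
qed

lemma kp_antipode:
  "tensor_lift (\<lambda>u v. kp_mult (kp_extend kp_antipode_basis u) v) (kp_extend kp_comult_basis x) =
    x $ E1 *s kp_one"
  "tensor_lift (\<lambda>u v. kp_mult u (kp_extend kp_antipode_basis v)) (kp_extend kp_comult_basis x) =
    x $ E1 *s kp_one"
  unfolding tensor_lift_def sum_kp_index vec_eq_iff forall_kp_index kp_comult_nth
  by (simp_all add: kp_mult_def kp_antipode_nth kp_one_def axis_def field_simps)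

lemma kp_counit:
  "tensor_lift (\<lambda>u v. u $ E1 *s v) (kp_extend kp_comult_basis x) = x"
  "tensor_lift (\<lambda>u v. v $ E1 *s u) (kp_extend kp_comult_basis x) = x"
  unfolding tensor_lift_def sum_kp_index vec_eq_iff forall_kp_index kp_comult_nth
  by (simp_all add: axis_def)

lemma kp_comult_one: "kp_extend kp_comult_basis kp_one = kp_one \<otimes> kp_one"
  unfolding vec_eq_iff
proof (intro allI)
  fix p :: "kp_index \<times> kp_index"
  show "kp_extend kp_comult_basis kp_one $ p = (kp_one \<otimes> kp_one) $ p"
    by (cases p; cases "fst p"; cases "snd p"; simp add: kp_comult_nth kp_one_def tensor_def axis_def)
qed

lemma hopf_algebra_kac_paljutkin: "hopf_algebra kac_paljutkin"
proof (intro hopf_algebra.intro unital_algebra.intro hopf_algebra_axioms.intro)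
  show "bilinear_map (hmult kac_paljutkin)"
    by (simp add: kac_paljutkin_def kp_mult_bilinear)
  show "hmult kac_paljutkin (hmult kac_paljutkin a b) c =
      hmult kac_paljutkin a (hmult kac_paljutkin b c)" for a b c
    by (simp add: kac_paljutkin_def vec_eq_iff forall_kp_index kp_mult_def algebra_simps)
  show "hmult kac_paljutkin (hone kac_paljutkin) a = a" for a
    by (simp add: kac_paljutkin_def vec_eq_iff forall_kp_index kp_mult_def kp_one_def axis_def)
  show "hmult kac_paljutkin a (hone kac_paljutkin) = a" for a
    by (simp add: kac_paljutkin_def vec_eq_iff forall_kp_index kp_mult_def kp_one_def axis_def)
  show "Vector_Spaces.linear (*s) (*) (counit kac_paljutkin)"
    by (simp add: kac_paljutkin_def Vector_Spaces.linear_iff vec.vector_space_axioms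
        vector_space_over_itself.vector_space_axioms)
  show "counit kac_paljutkin (hmult kac_paljutkin a b) =
      counit kac_paljutkin a * counit kac_paljutkin b" for a b
    by (simp add: kac_paljutkin_def kp_mult_def)
  show "counit kac_paljutkin (hone kac_paljutkin) = 1"
    by (simp add: kac_paljutkin_def kp_one_def axis_def)
  show "comult kac_paljutkin (hmult kac_paljutkin a b) =
      tensor_mult kac_paljutkin (comult kac_paljutkin a) (comult kac_paljutkin b)" for a b
    using kp_comult_mult[of a b] by (simp add: kac_paljutkin_def)
qed (simp_all add: kac_paljutkin_def kp_extend_linear kp_coassoc kp_counit kp_antipode kp_comult_one)

section \<open>Semisimplicity by orthogonal complements\<close>

lemma inner_kp_mult:
  "kp_mult a x \<bullet> y = x \<bullet> kp_mult (\<chi> k. cnj (kp_extend kp_antipode_basis a $ k)) y"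
  \<comment> \<open>The antipode exchanges the two off-diagonal matrix units, so conjugating the
    coordinates of S(\<open>a\<close>) yields the adjoint of \<open>a\<close>. The inner product is
    the real part of the standard Hermitian one.\<close>
  by (simp add: inner_vec_def inner_complex_def sum_kp_index kp_mult_def kp_antipode_nth algebra_simps)

text \<open>Moving a complex scalar to the other argument conjugates it. Hence the orthogonal
  complement of a complex subspace for the real inner product is again a complex subspace.\<close>

lemma inner_scale_complex: "(c *s x) \<bullet> y = x \<bullet> (cnj c *s y)" for x y :: "complex ^ 'n"
  unfolding inner_vec_def
  by (intro sum.cong refl) (simp add: inner_complex_def algebra_simps)

lemma semisimple_kac_paljutkin: "semisimple_hopf_algebra kac_paljutkin"
proof -
  interpret hopf_algebra kac_paljutkin
    by (rule hopf_algebra_kac_paljutkin)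
  show ?thesis
  proof
    fix I assume I: "left_ideal kac_paljutkin I"
    define J where "J = {y. \<forall>x\<in>I. x \<bullet> y = 0}"
    have complex_subspace: "vec.subspace I"
      using I by (simp add: left_ideal_def)
    have ideal: "kp_mult a x \<in> I" if "x \<in> I" for a x
      using I that by (simp add: left_ideal_def kac_paljutkin_def)
    \<comment> \<open>The orthogonal decomposition below is taken over the reals, so
      \<open>I\<close> must also be seen as a real subspace.\<close>
    have real_scale: "r *\<^sub>R x = complex_of_real r *s x" for r and x :: kp
      by (simp add: vec_eq_iff scaleR_conv_of_real[where 'a = complex])
    have "subspace I"
      using complex_subspace by (simp add: subspace_def vec.subspace_def real_scale)
    have "left_ideal kac_paljutkin J"
    proof -
      have "c *s y \<in> J" if "y \<in> J" for c y
      proof -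
        have "x \<bullet> (c *s y) = 0" if "x \<in> I" for x
          using \<open>y \<in> J\<close> complex_subspace that inner_scale_complex[of "cnj c" x y]
          by (simp add: J_def vec.subspace_scale)
        then show ?thesis by (simp add: J_def)
      qed
      moreover have "kp_mult a y \<in> J" if "y \<in> J" for a y
      proof -
        have "kp_mult a y \<bullet> x = 0" if "x \<in> I" for x
          unfolding inner_kp_mult
          using \<open>y \<in> J\<close> ideal[OF that] by (simp add: J_def inner_commute[of y])
        then show ?thesis by (simp add: J_def inner_commute)
      qed
      ultimately show ?thesis
        by (simp add: left_ideal_def vec.subspace_def kac_paljutkin_def)
          (auto simp: J_def inner_add_right)
    qed
    moreover have "I \<inter> J = {0}"
      using complex_subspace by (auto simp: J_def vec.subspace_0)
    moreover have "z \<in> {x + y | x y. x \<in> I \<and> y \<in> J}" for z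
    proof -
      obtain x y where "x \<in> span I" "\<And>w. w \<in> span I \<Longrightarrow> orthogonal y w" "z = x + y"
        using orthogonal_subspace_decomp_exists[of I z] by blast
      moreover from this have "y \<in> J"
        by (auto simp: J_def orthogonal_def span_base inner_commute)
      moreover have "span I = I"
        using \<open>subspace I\<close> by (rule span_eq_iff[THEN iffD2])
      ultimately show ?thesis by auto
    qed
    ultimately show "\<exists>J. left_ideal kac_paljutkin J \<and> I \<inter> J = {0} \<and>
        {x + y | x y. x \<in> I \<and> y \<in> J} = UNIV"
      by blast
  qed
qed

section \<open>Nilpotency\<close>

lemma nilpotent_kac_paljutkin: "nilpotent kac_paljutkin"
proof -
  interpret hopf_algebra kac_paljutkin
    by (rule hopf_algebra_kac_paljutkin)
  \<comment> \<open>The equations cut out the span of \<open>e\<close> and \<open>f\<close>, with x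
    = \<open>x $ E1\<close> e + \<open>x $ A11\<close> f for every member, so membership is a
    condition on coordinates.\<close>
  define L :: "kp set" where "L = {x. x $ E2 = x $ E1 \<and> x $ E3 = x $ E1 \<and> x $ E4 = x $ E1 \<and>
    x $ A12 = 0 \<and> x $ A21 = 0 \<and> x $ A22 = x $ A11}"
  define e :: kp where "e = \<b> E1 + \<b> E2 + \<b> E3 + \<b> E4"
  define f :: kp where "f = \<b> A11 + \<b> A22"
  have "e \<in> L" "f \<in> L"
    by (simp_all add: e_def f_def L_def axis_def)
  have "vec.subspace L"
    by (auto simp: vec.subspace_def L_def)
  \<comment> \<open>The coproduct of e is e \<otimes> e + f \<otimes> f, and that of f is e
    \<otimes> f + f \<otimes> e, as for functions on the group of order two. The formula collects
    the terms by their right factor, which shows the left coideal property directly.\<close>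
  have comult_L: "kp_extend kp_comult_basis x = x \<otimes> e + (x $ A11 *s e + x $ E1 *s f) \<otimes> f"
    if "x \<in> L" for x
  proof -
    have "kp_extend kp_comult_basis x $ (p, q) =
        (x \<otimes> e + (x $ A11 *s e + x $ E1 *s f) \<otimes> f) $ (p, q)" for p q
      using that unfolding kp_comult_nth
      by (cases p; cases q; simp add: L_def e_def f_def tensor_def axis_def)
    then show ?thesis by (simp add: vec_eq_iff)
  qed
  have "kp_extend kp_comult_basis x \<in> vec.span {a \<otimes> y | a y. y \<in> L}" if "x \<in> L" for x
    unfolding comult_L[OF that]
    by (intro vec.span_add vec.span_base) (use \<open>e \<in> L\<close> \<open>f \<in> L\<close> in blast)+
  then have "left_coideal_subalgebra kac_paljutkin L"
    using \<open>vec.subspace L\<close>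
    by (auto simp: left_coideal_subalgebra_def unital_subalgebra_def kac_paljutkin_def)
      (simp_all add: L_def kp_one_def kp_mult_def axis_def)
  \<comment> \<open>The idempotents e and f are orthogonal, with counits 1 and 0, so multiplying e
    by a member of \<open>L\<close> only scales it by the \<open>E1\<close> coordinate.\<close>
  moreover have "is_integral kac_paljutkin L e"
    using \<open>e \<in> L\<close>
    by (auto simp: is_integral_def kac_paljutkin_def vec_eq_iff forall_kp_index)
      (simp_all add: L_def e_def kp_mult_def axis_def)
  moreover have "hmult kac_paljutkin x a = hmult kac_paljutkin a x" if "x \<in> L" for a x
    using that by (simp add: L_def kac_paljutkin_def vec_eq_iff forall_kp_index kp_mult_def)
  moreover have "hmult kac_paljutkin (hmult kac_paljutkin a e) (hmult kac_paljutkin b e) =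
      hmult kac_paljutkin (hmult kac_paljutkin b e) (hmult kac_paljutkin a e)" for a b
    by (simp add: e_def kac_paljutkin_def vec_eq_iff forall_kp_index kp_mult_def axis_def)
  moreover have "L \<noteq> {c *s hone kac_paljutkin | c. True}"
  proof -
    have "e \<noteq> c *s kp_one" for c
      by (auto simp: e_def kp_one_def vec_eq_iff forall_kp_index axis_def)
    then show ?thesis
      using \<open>e \<in> L\<close> by (auto simp: kac_paljutkin_def)
  qed
  moreover have "L \<noteq> UNIV"
  proof -
    have "\<b> E1 \<notin> L" by (simp add: L_def axis_def)
    then show ?thesis by blast
  qed
  ultimately show ?thesis
    by (rule nilpotent_if_central_extension)
qed

theorem theorem3p4:
  shows "semisimple_hopf_algebra kac_paljutkin \<and> nilpotent kac_paljutkin"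
  using semisimple_kac_paljutkin nilpotent_kac_paljutkin by simp

end
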